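(* In the setting of the context (independent observations $X_1,\dots,X_n$, true parameter value $\theta\in\Theta$, $\Theta\subset\mathbb R$ open, preliminary consistent estimator $\theta_n^*$), suppose the following. (R2) With probability $1$, for every $i$, $M_i(t_2,X_i)-M_i(t_1,X_i)=\int_{t_1}^{t_2}M_i'(t,X_i)\,dt$ for every interval $(t_1,t_2)$ lying entirely in $\Theta$; moreover $\mathbf E M_i(\theta,X_i)=0$, $\mathbf E M_i^2(\theta,X_i)<\infty$, $\mathbf E|M_i'(\theta,X_i)|<\infty$ for every $i$; and for some $p\in(0,1]$, $|h_i(t_1)-h_i(t_2)|\le \overline h_i|t_1-t_2|^p$ for all $t_1,t_2\in\Theta$ and all $i$. (R3) For all sufficiently large $n$, $I_{n,h}:=\sum_{i=1}^n h_i^2(\theta)\mathbf E M_i^2(\theta,X_i)>0$ and $J_{n,h}:=\sum_{i=1}^n h_i(\theta)\mathbf E M_i'(\theta,X_i)\neq0$; and as $n\to\infty$: $|J_{n,h}|/\sqrt{I_{n,h}}\to\infty$, $\sum_{i=1}^n h_i(\theta)M_i'(\theta,X_i)/J_{n,h}\to 1$ in probability, and $\sum_{i=1}^n h_i(\theta)M_i(\theta,X_i)/\sqrt{I_{n,h}}\Rightarrow\mathcal N(0,1)$. (R4) $\lim_{\delta\to0}\limsup_{n\to\infty}\sum_{i=1}^n\big(|h_i(\theta)|+\delta^p\overline h_i\big)\overline\tau_i(\delta)/|J_{n,h}|=0$. (R5) $|\theta_n^*-\theta|\sum_{i=1}^n\big(\overline h_i|\theta_n^*-\theta|^p+|h_i(\theta)|\big)\overline\tau_i(|\theta_n^*-\theta|)/\sqrt{I_{n,h}}\to0$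 in probability and $|\theta_n^*-\theta|^p\sum_{i=1}^n\overline h_i\,\mathbf E|M_i'(\theta,X_i)|/|J_{n,h}|\to0$ in probability. Suppose in addition that $$\delta_n^h:=\sum_{i=1}^n\big(h_i(\theta_n^* )-h_i(\theta)\big)M_i(\theta,X_i)/\sqrt{I_{n,h}}\to0\quad\text{in probability}.$$ Then the one-step weighted $M$-estimator $$\theta_{n,M,h}^{**}=\theta_n^*-\frac{\sum_{i=1}^n h_i(\theta_n^* )M_i(\theta_n^*,X_i)}{\sum_{i=1}^n h_i(\theta_n^* )M_i'(\theta_n^*,X_i)}$$ is well defined with probability tending to $1$ as $n\to\infty$, and $$\frac{J_{n,h}}{\sqrt{I_{n,h}}}\big(\theta_{n,M,h}^{**}-\theta\big)\Longrightarrow\mathcal N(0,1).$$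
   Context: All limits are as $n\to\infty$ unless stated otherwise; $\Rightarrow$ denotes weak convergence of distributions. For each $n$ one observes independent (not necessarily identically distributed) random elements $X_1,\dots,X_n$ with values in an arbitrary measurable space $\mathcal X$; their distributions depend on an unknown parameter $\theta\in\Theta\subset\mathbb R$, $\Theta$ open, and may depend on $n$ (triangular array) and on nuisance parameters. $\theta$ denotes the fixed true value. For each $i$ there are given real functions $h_i(t)$, $M_i(t,X_i)$, $M_i'(t,X_i)$, $t\in\Theta$ (possibly depending on $n$; $M_i'$ plays the role of the derivative of $M_i$ in $t$), and constants $\overline h_i\ge0$ (possibly depending on $n$). $\theta_n^*$ is a real-valued statistic (function of $X_1,\dots,X_n$), a preliminary estimator consistent for $\theta$. For $\delta\ge0$ put $\overline\tau_i(\delta):=\mathbf E\,\tau_i(\delta,X_i)$, where $\tau_i(\delta,X_i):=\sup_{t:|t-\theta|\le\delta}|M_i'(t,X_i)-M_i'(\theta,X_i)|$ if $[\theta-\delta,\theta+\delta]\subset\Theta$, and $\tau_i(\delta,X_i):=\infty$ otherwise. Here $\overline\tau_i(|\theta_n^*-\theta|)$ means the deterministic function $\overline\tau_i(\cdot)$ evaluated at the random point $|\theta_n^*-\theta|$. A statistic is "well defined" at a sample point if all quantities in its formula are defined and its denominator is nonzero. *)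

theory Defs
  imports "HOL-Probability.Probability"
begin

text \<open>
  Conventions.  \<open>P n\<close> is the probability measure, under the true parameter value \<open>\<theta>\<close>, of the
  \<open>n\<close>-th row of the triangular array; \<open>X n i\<close> (\<open>i = 1, ..., n\<close>) are the observations.
  The functions \<open>h n i\<close>, \<open>M n i\<close>, \<open>M' n i\<close> matter only at arguments \<open>t \<in> \<Theta>\<close>; their values at other
  arguments are junk, never constrained by the hypotheses.
\<close>

text \<open>The random variables may live on a different probability space for every \<open>n\<close>.
  Measurability is part of the notion, because \<open>measure\<close> is \<open>0\<close> on non-measurable sets.
  The extended version is needed because \<open>tau_bar\<close> below may be infinite.\<close>

definition vanishes_in_prob :: "(nat \<Rightarrow> 'w measure) \<Rightarrow> (nat \<Rightarrow> 'w \<Rightarrow> ennreal) \<Rightarrow> bool" where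
  "vanishes_in_prob P Z \<longleftrightarrow>
     (\<forall>n. Z n \<in> borel_measurable (P n)) \<and>
     (\<forall>\<epsilon>::real. 0 < \<epsilon> \<longrightarrow>
        (\<lambda>n. measure (P n) {\<omega> \<in> space (P n). ennreal \<epsilon> < Z n \<omega>}) \<longlonglongrightarrow> 0)"

definition tendsto_in_prob ::
  "(nat \<Rightarrow> 'w measure) \<Rightarrow> (nat \<Rightarrow> 'w \<Rightarrow> real) \<Rightarrow> real \<Rightarrow> bool" where
  "tendsto_in_prob P Y c \<longleftrightarrow>
     (\<forall>n. Y n \<in> borel_measurable (P n)) \<and>
     (\<forall>\<epsilon>::real. 0 < \<epsilon> \<longrightarrow>
        (\<lambda>n. measure (P n) {\<omega> \<in> space (P n). \<epsilon> < \<bar>Y n \<omega> - c\<bar>}) \<longlonglongrightarrow> 0)"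

definition tau :: "real set \<Rightarrow> real \<Rightarrow> (real \<Rightarrow> 'x \<Rightarrow> real) \<Rightarrow> real \<Rightarrow> 'x \<Rightarrow> ennreal" where
  "tau \<Theta> \<theta> m' \<delta> x =
     (if {\<theta> - \<delta>..\<theta> + \<delta>} \<subseteq> \<Theta>
      then (SUP t\<in>{t. \<bar>t - \<theta>\<bar> \<le> \<delta>}. ennreal \<bar>m' t x - m' \<theta> x\<bar>)
      else \<infinity>)"

definition tau_bar ::
  "'w measure \<Rightarrow> ('w \<Rightarrow> 'x) \<Rightarrow> real set \<Rightarrow> real \<Rightarrow> (real \<Rightarrow> 'x \<Rightarrow> real) \<Rightarrow> real \<Rightarrow> ennreal" where
  "tau_bar Q Y \<Theta> \<theta> m' \<delta> = (\<integral>\<^sup>+\<omega>. tau \<Theta> \<theta> m' \<delta> (Y \<omega>) \<partial>Q)"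

definition I_nh ::
  "(nat \<Rightarrow> 'w measure) \<Rightarrow> (nat \<Rightarrow> nat \<Rightarrow> 'w \<Rightarrow> 'x) \<Rightarrow> real \<Rightarrow> (nat \<Rightarrow> nat \<Rightarrow> real \<Rightarrow> real)
   \<Rightarrow> (nat \<Rightarrow> nat \<Rightarrow> real \<Rightarrow> 'x \<Rightarrow> real) \<Rightarrow> nat \<Rightarrow> real" where
  "I_nh P X \<theta> h M n = (\<Sum>i=1..n. (h n i \<theta>)\<^sup>2 * (\<integral>\<omega>. (M n i \<theta> (X n i \<omega>))\<^sup>2 \<partial>P n))"

definition J_nh ::
  "(nat \<Rightarrow> 'w measure) \<Rightarrow> (nat \<Rightarrow> nat \<Rightarrow> 'w \<Rightarrow> 'x) \<Rightarrow> real \<Rightarrow> (nat \<Rightarrow> nat \<Rightarrow> real \<Rightarrow> real)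
   \<Rightarrow> (nat \<Rightarrow> nat \<Rightarrow> real \<Rightarrow> 'x \<Rightarrow> real) \<Rightarrow> nat \<Rightarrow> real" where
  "J_nh P X \<theta> h M' n = (\<Sum>i=1..n. h n i \<theta> * (\<integral>\<omega>. M' n i \<theta> (X n i \<omega>) \<partial>P n))"

text \<open>Below, \<open>t\<close> is the value of the preliminary estimator and \<open>x i\<close> the value of the \<open>i\<close>-th
  observation.  The formula is meaningful only where \<open>one_step_well_defined\<close> holds: there \<open>t \<in> \<Theta>\<close>, so
  that all functions are evaluated in their domain, and the denominator does not vanish.\<close>

definition weighted_sum ::
  "(nat \<Rightarrow> nat \<Rightarrow> real \<Rightarrow> real) \<Rightarrow> (nat \<Rightarrow> nat \<Rightarrow> real \<Rightarrow> 'x \<Rightarrow> real)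
   \<Rightarrow> nat \<Rightarrow> real \<Rightarrow> (nat \<Rightarrow> 'x) \<Rightarrow> real" where
  "weighted_sum h F n t x = (\<Sum>i=1..n. h n i t * F n i t (x i))"

definition one_step ::
  "(nat \<Rightarrow> nat \<Rightarrow> real \<Rightarrow> real) \<Rightarrow> (nat \<Rightarrow> nat \<Rightarrow> real \<Rightarrow> 'x \<Rightarrow> real)
   \<Rightarrow> (nat \<Rightarrow> nat \<Rightarrow> real \<Rightarrow> 'x \<Rightarrow> real) \<Rightarrow> nat \<Rightarrow> real \<Rightarrow> (nat \<Rightarrow> 'x) \<Rightarrow> real" where
  "one_step h M M' n t x = t - weighted_sum h M n t x / weighted_sum h M' n t x"

definition one_step_well_defined ::
  "real set \<Rightarrow> (nat \<Rightarrow> nat \<Rightarrow> real \<Rightarrow> real) \<Rightarrow> (nat \<Rightarrow> nat \<Rightarrow> real \<Rightarrow> 'x \<Rightarrow> real)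
   \<Rightarrow> nat \<Rightarrow> real \<Rightarrow> (nat \<Rightarrow> 'x) \<Rightarrow> bool" where
  "one_step_well_defined \<Theta> h M' n t x \<longleftrightarrow> t \<in> \<Theta> \<and> weighted_sum h M' n t x \<noteq> 0"

end

theory Submission
  imports Defs
begin

text \<open>
  Write \<open>t\<close> for the preliminary estimator, \<open>d = \<bar>t - \<theta>\<bar>\<close>, \<open>s = sqrt I\<^sub>n\<^sub>,\<^sub>h\<close>, \<open>J = J\<^sub>n\<^sub>,\<^sub>h\<close>, and \<open>D\<close> for the
  denominator of the one-step estimator.  Newton's step almost cancels the first-order error of \<open>t\<close>:
  multiplying the error of the one-step estimator by \<open>D\<close> gives (\<open>one_step_error\<close>)
  the main term \<open>- \<Sum>i. h\<^sub>i(\<theta>) M\<^sub>i(\<theta>)\<close>, the term \<open>- s \<delta>\<^sub>n\<^sup>h\<close>, and two remainders which measure how much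
  \<open>M\<^sub>i'\<close> varies between \<open>\<theta>\<close> and \<open>t\<close>.  By the integral representation of \<open>M\<^sub>i\<close> each remainder is at most
  \<open>d \<Sum>i. \<bar>h\<^sub>i(t)\<bar> \<tau>\<^sub>i(d)\<close> (\<open>first_order_remainder_le_tau\<close>), where the Hoelder condition replaces
  \<open>\<bar>h\<^sub>i(t)\<bar>\<close> by the deterministic weight \<open>\<bar>h\<^sub>i(\<theta>)\<bar> + d\<^sup>p hbar\<^sub>i\<close> (\<open>weighted_sum_le_majorant\<close>).  The
  difference \<open>D / J - 1\<close> is treated in the same way.  So, with high probability,
  \<open>(1 + a) Y = - S + e\<close>, where \<open>Y\<close> is the normalized error of the one-step estimator, \<open>S\<close> the
  asymptotically normal sum, and \<open>a\<close>, \<open>e\<close> are small; a Slutsky argument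
  (\<open>weak_conv_m_asymptotically_equal\<close>) and the symmetry of the normal law finish the proof.

  The delicate point is that the hypotheses control the expectation of \<open>\<tau>\<^sub>i(\<delta>, X\<^sub>i)\<close> at a fixed radius
  \<open>\<delta>\<close>, with the random radius \<open>d\<close> inserted only afterwards, whereas the remainders contain
  \<open>\<tau>\<^sub>i(d, X\<^sub>i)\<close> with \<open>d\<close> and \<open>X\<^sub>i\<close> dependent.  What saves the argument is monotonicity in the radius
  (\<open>with_high_prob_at_random_radius\<close>): the radii whose mean is at most \<open>\<epsilon>\<close> form an interval, and
  Markov's inequality, applied along a sequence of radii increasing to its right end, controls all
  radii in the interval outside one single exceptional set.
\<close>

section \<open>Events of probability tending to one\<close>

text \<open>The exceptional set \<open>B\<close> may be larger than the set where \<open>Q\<close> fails: the latter need not be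
  measurable, for example when \<open>Q\<close> involves a supremum evaluated at a random radius.\<close>

definition with_high_prob :: "(nat \<Rightarrow> 'w measure) \<Rightarrow> (nat \<Rightarrow> 'w \<Rightarrow> bool) \<Rightarrow> bool" where
  "with_high_prob P Q \<longleftrightarrow>
     (\<forall>\<kappa>>0. \<forall>\<^sub>F n in sequentially.
        \<exists>B\<in>sets (P n). measure (P n) B \<le> \<kappa> \<and> (\<forall>\<omega>\<in>space (P n) - B. Q n \<omega>))"

lemma with_high_probD:
  assumes "with_high_prob P Q" "0 < \<kappa>"
  shows "\<forall>\<^sub>F n in sequentially.
           \<exists>B\<in>sets (P n). measure (P n) B \<le> \<kappa> \<and> (\<forall>\<omega>\<in>space (P n) - B. Q n \<omega>)"
  using assms unfolding with_high_prob_def by blast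

lemma with_high_prob_mono:
  assumes "with_high_prob P Q"
    and "\<forall>\<^sub>F n in sequentially. \<forall>\<omega>\<in>space (P n). Q n \<omega> \<longrightarrow> R n \<omega>"
  shows "with_high_prob P R"
  unfolding with_high_prob_def
proof (intro allI impI)
  fix \<kappa> :: real assume "0 < \<kappa>"
  from with_high_probD[OF assms(1) this] assms(2)
  show "\<forall>\<^sub>F n in sequentially.
      \<exists>B\<in>sets (P n). measure (P n) B \<le> \<kappa> \<and> (\<forall>\<omega>\<in>space (P n) - B. R n \<omega>)"
    by eventually_elim blast
qed

lemma with_high_prob_conj:
  assumes "with_high_prob P Q" "with_high_prob P R"
  shows "with_high_prob P (\<lambda>n \<omega>. Q n \<omega> \<and> R n \<omega>)"
  unfolding with_high_prob_def
proof (intro allI impI)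
  fix \<kappa> :: real assume "0 < \<kappa>"
  then have "0 < \<kappa> / 2" by simp
  from with_high_probD[OF assms(1) this] with_high_probD[OF assms(2) this]
  show "\<forall>\<^sub>F n in sequentially.
      \<exists>B\<in>sets (P n). measure (P n) B \<le> \<kappa> \<and> (\<forall>\<omega>\<in>space (P n) - B. Q n \<omega> \<and> R n \<omega>)"
  proof eventually_elim
    case (elim n)
    then obtain B C where BC: "B \<in> sets (P n)" "measure (P n) B \<le> \<kappa> / 2"
        "C \<in> sets (P n)" "measure (P n) C \<le> \<kappa> / 2"
        "\<forall>\<omega>\<in>space (P n) - B. Q n \<omega>" "\<forall>\<omega>\<in>space (P n) - C. R n \<omega>"
      by blast
    have "measure (P n) (B \<union> C) \<le> measure (P n) B + measure (P n) C"
      using BC by (intro measure_Un_le)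
    then show ?case
      using BC by (intro bexI[of _ "B \<union> C"]) auto
  qed
qed

lemma with_high_probI_measure:
  assumes "\<And>n. {\<omega>\<in>space (P n). \<not> Q n \<omega>} \<in> sets (P n)"
    and "(\<lambda>n. measure (P n) {\<omega>\<in>space (P n). \<not> Q n \<omega>}) \<longlonglongrightarrow> 0"
  shows "with_high_prob P Q"
  unfolding with_high_prob_def
proof (intro allI impI)
  fix \<kappa> :: real assume "0 < \<kappa>"
  from order_tendstoD(2)[OF assms(2) this]
  show "\<forall>\<^sub>F n in sequentially.
      \<exists>B\<in>sets (P n). measure (P n) B \<le> \<kappa> \<and> (\<forall>\<omega>\<in>space (P n) - B. Q n \<omega>)"
    by eventually_elim
      (use assms(1) in \<open>intro bexI[of _ "{\<omega>\<in>space (P _). \<not> Q _ \<omega>}"], auto\<close>)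
qed

lemma with_high_prob_AE:
  assumes "\<And>n. AE \<omega> in P n. Q n \<omega>"
  shows "with_high_prob P Q"
  unfolding with_high_prob_def
proof (intro allI impI always_eventually)
  fix \<kappa> :: real and n assume "0 < \<kappa>"
  obtain N where "N \<in> null_sets (P n)" "{\<omega> \<in> space (P n). \<not> Q n \<omega>} \<subseteq> N"
    using assms[of n] by (auto simp: eventually_ae_filter)
  with \<open>0 < \<kappa>\<close> show "\<exists>B\<in>sets (P n). measure (P n) B \<le> \<kappa> \<and> (\<forall>\<omega>\<in>space (P n) - B. Q n \<omega>)"
    by (intro bexI[of _ N]) (auto simp: measure_eq_0_null_sets)
qed

lemma tendsto_in_prob_with_high_prob:
  assumes "tendsto_in_prob P Y c" "0 < \<epsilon>"
  shows "with_high_prob P (\<lambda>n \<omega>. \<bar>Y n \<omega> - c\<bar> \<le> \<epsilon>)"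
proof (rule with_high_probI_measure)
  have [measurable]: "Y n \<in> borel_measurable (P n)" for n
    using assms(1) by (simp add: tendsto_in_prob_def)
  show "{\<omega> \<in> space (P n). \<not> \<bar>Y n \<omega> - c\<bar> \<le> \<epsilon>} \<in> sets (P n)" for n
    by measurable
  show "(\<lambda>n. measure (P n) {\<omega> \<in> space (P n). \<not> \<bar>Y n \<omega> - c\<bar> \<le> \<epsilon>}) \<longlonglongrightarrow> 0"
    using assms by (simp add: tendsto_in_prob_def not_le)
qed

lemma vanishes_in_prob_with_high_prob:
  assumes "vanishes_in_prob P Z" "0 < \<epsilon>"
  shows "with_high_prob P (\<lambda>n \<omega>. Z n \<omega> \<le> ennreal \<epsilon>)"
proof (rule with_high_probI_measure)
  have [measurable]: "Z n \<in> borel_measurable (P n)" for n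
    using assms(1) by (simp add: vanishes_in_prob_def)
  show "{\<omega> \<in> space (P n). \<not> Z n \<omega> \<le> ennreal \<epsilon>} \<in> sets (P n)" for n
    by measurable
  show "(\<lambda>n. measure (P n) {\<omega> \<in> space (P n). \<not> Z n \<omega> \<le> ennreal \<epsilon>}) \<longlonglongrightarrow> 0"
    using assms by (simp add: vanishes_in_prob_def not_le)
qed

lemma with_high_prob_measure_tendsto_1:
  assumes prob: "\<And>n. prob_space (P n)"
    and sets: "\<And>n. {\<omega>\<in>space (P n). Q n \<omega>} \<in> sets (P n)"
    and "with_high_prob P Q"
  shows "(\<lambda>n. measure (P n) {\<omega>\<in>space (P n). Q n \<omega>}) \<longlonglongrightarrow> 1"
proof (rule order_tendstoI)
  fix a :: real assume "a < 1"
  then have "0 < (1 - a) / 2" by simp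
  from with_high_probD[OF assms(3) this]
  show "\<forall>\<^sub>F n in sequentially. a < measure (P n) {\<omega>\<in>space (P n). Q n \<omega>}"
  proof eventually_elim
    case (elim n)
    interpret prob_space "P n" by (rule prob)
    obtain B where B: "B \<in> sets (P n)" "prob B \<le> (1 - a) / 2" "\<forall>\<omega>\<in>space (P n) - B. Q n \<omega>"
      using elim by blast
    have "prob (space (P n) - B) \<le> prob {\<omega>\<in>space (P n). Q n \<omega>}"
      using B sets by (intro finite_measure_mono) auto
    moreover have "prob (space (P n) - B) = 1 - prob B"
      using B by (simp add: prob_compl)
    ultimately show ?case using B \<open>a < 1\<close> by (simp add: field_simps)
  qed
next
  fix a :: real assume "1 < a"
  then show "\<forall>\<^sub>F n in sequentially. measure (P n) {\<omega>\<in>space (P n). Q n \<omega>} < a"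
    using prob_space.prob_le_1[OF prob] by (intro always_eventually allI) (rule le_less_trans)
qed

section \<open>Evaluating a monotone family at a random radius\<close>

text \<open>Without a maximum, \<open>A\<close> is cofinally approximated by its rational points, because it is an
  interval; running maxima of an enumeration make the sequence monotone.\<close>

lemma real_downset_cofinal_sequence:
  fixes A :: "real set"
  assumes "0 \<in> A" and nonneg: "\<And>a. a \<in> A \<Longrightarrow> 0 \<le> a"
    and down: "\<And>a b. b \<in> A \<Longrightarrow> 0 \<le> a \<Longrightarrow> a \<le> b \<Longrightarrow> a \<in> A"
  obtains f :: "nat \<Rightarrow> real"
  where "incseq f" "range f \<subseteq> A" "\<And>a. a \<in> A \<Longrightarrow> \<exists>k. a \<le> f k"
proof (cases "\<exists>m\<in>A. \<forall>a\<in>A. a \<le> m")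
  case True
  then obtain m where "m \<in> A" "\<forall>a\<in>A. a \<le> m" by blast
  then show ?thesis by (intro that[of "\<lambda>_. m"]) auto
next
  case False
  define C where "C = A \<inter> \<rat>"
  have C0: "0 \<in> C" using assms(1) by (simp add: C_def)
  have "countable C" unfolding C_def by (simp add: countable_rat countable_Int2)
  with C0 obtain e :: "nat \<Rightarrow> real" where e: "range e = C"
    using range_from_nat_into[of C] by blast
  define f where "f k = Max (e ` {..k})" for k
  have "f k \<in> e ` {..k}" for k
    unfolding f_def by (rule Max_in) auto
  then have "f k \<in> C" for k using e by auto
  then have "range f \<subseteq> A" by (auto simp: C_def)
  moreover have "incseq f"
    unfolding f_def by (intro incseq_SucI Max_mono) auto
  moreover have "\<exists>k. a \<le> f k" if "a \<in> A" for a
  proof -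
    obtain b where "b \<in> A" "a < b" using False \<open>a \<in> A\<close> by (meson not_le)
    then obtain q where q: "q \<in> \<rat>" "a < q" "q < b" using Rats_dense_in_real by blast
    then have "q \<in> C"
      using down[OF \<open>b \<in> A\<close>, of q] nonneg[OF \<open>a \<in> A\<close>] by (simp add: C_def)
    then obtain k where "q = e k" using e by (metis imageE)
    then have "q \<le> f k" unfolding f_def by (intro Max_ge) auto
    with q show ?thesis by (intro exI[of _ k]) simp
  qed
  ultimately show ?thesis using that by blast
qed

text \<open>One exceptional set serves all radii with small mean, so the radius may afterwards depend on
  \<open>\<omega>\<close>.  The events \<open>g \<delta> > c\<close> increase with \<open>\<delta>\<close>; hence their union over a cofinal sequence of admissible
  radii obeys the same Markov bound \<open>\<epsilon> / c\<close> as each of them, even if the supremum of the admissible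
  radii is not itself admissible.\<close>

lemma (in prob_space) monotone_family_exceptional_set:
  fixes g :: "real \<Rightarrow> 'a \<Rightarrow> ennreal"
  assumes meas: "\<And>\<delta>. 0 \<le> \<delta> \<Longrightarrow> g \<delta> \<in> borel_measurable M"
    and mono: "\<And>\<delta> \<delta>' \<omega>. 0 \<le> \<delta> \<Longrightarrow> \<delta> \<le> \<delta>' \<Longrightarrow> g \<delta> \<omega> \<le> g \<delta>' \<omega>"
    and "0 \<le> \<epsilon>" "0 < c"
  obtains B where "B \<in> sets M" "measure M B \<le> \<epsilon> / c"
    "\<And>\<delta> \<omega>. 0 \<le> \<delta> \<Longrightarrow> (\<integral>\<^sup>+\<omega>'. g \<delta> \<omega>' \<partial>M) \<le> ennreal \<epsilon> \<Longrightarrow> \<omega> \<in> space M - B \<Longrightarrow> g \<delta> \<omega> \<le> ennreal c"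
proof -
  define A where "A = {\<delta>. 0 \<le> \<delta> \<and> (\<integral>\<^sup>+\<omega>'. g \<delta> \<omega>' \<partial>M) \<le> ennreal \<epsilon>}"
  have down: "a \<in> A" if "b \<in> A" "0 \<le> a" "a \<le> b" for a b
    using that nn_integral_mono[of M "g a" "g b"] mono[of a b] by (auto simp: A_def intro: order_trans)
  show ?thesis
  proof (cases "0 \<in> A")
    case False
    then have "A = {}" using down[of _ 0] by (auto simp: A_def)
    with assms show ?thesis by (intro that[of "{}"]) (auto simp: A_def)
  next
    case True
    obtain f where f: "incseq f" "range f \<subseteq> A" "\<And>a. a \<in> A \<Longrightarrow> \<exists>k. a \<le> f k"
      by (rule real_downset_cofinal_sequence[of A]) (use True down in \<open>auto simp: A_def\<close>)
    have f0: "0 \<le> f k" and fi: "(\<integral>\<^sup>+\<omega>'. g (f k) \<omega>' \<partial>M) \<le> ennreal \<epsilon>" for k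
      using f(2) by (auto simp: A_def)
    note [measurable] = meas[OF f0]
    define E where "E k = {\<omega> \<in> space M. ennreal c < g (f k) \<omega>}" for k
    have E[measurable]: "E k \<in> sets M" for k unfolding E_def by measurable
    have Ek: "emeasure M (E k) \<le> ennreal (\<epsilon> / c)" for k
    proof -
      have "ennreal c * emeasure M (E k) = (\<integral>\<^sup>+\<omega>. ennreal c * indicator (E k) \<omega> \<partial>M)"
        by (simp add: nn_integral_cmult_indicator)
      also have "\<dots> \<le> (\<integral>\<^sup>+\<omega>. g (f k) \<omega> \<partial>M)"
        by (intro nn_integral_mono) (auto simp: E_def indicator_def)
      also have "\<dots> \<le> ennreal \<epsilon>" by (rule fi)
      finally have "ennreal c * ennreal (measure M (E k)) \<le> ennreal \<epsilon>"
        by (simp add: emeasure_eq_measure)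
      then have "c * measure M (E k) \<le> \<epsilon>"
        using assms by (simp add: ennreal_mult[symmetric])
      then show ?thesis
        using assms by (simp add: emeasure_eq_measure field_simps)
    qed
    have "incseq E"
    proof (rule incseq_SucI)
      fix k
      have "g (f k) \<omega> \<le> g (f (Suc k)) \<omega>" for \<omega>
        using f(1) f0 by (intro mono) (auto simp: incseq_Suc_iff)
      then show "E k \<subseteq> E (Suc k)" by (auto simp: E_def intro: less_le_trans)
    qed
    then have "emeasure M (\<Union>k. E k) = (SUP k. emeasure M (E k))"
      by (intro SUP_emeasure_incseq[symmetric]) auto
    also have "\<dots> \<le> ennreal (\<epsilon> / c)" by (intro SUP_least Ek)
    finally have "measure M (\<Union>k. E k) \<le> \<epsilon> / c"
      using assms by (simp add: emeasure_eq_measure)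
    moreover have "g \<delta> \<omega> \<le> ennreal c"
      if "0 \<le> \<delta>" "(\<integral>\<^sup>+\<omega>'. g \<delta> \<omega>' \<partial>M) \<le> ennreal \<epsilon>" "\<omega> \<in> space M - (\<Union>k. E k)" for \<delta> \<omega>
    proof -
      have "\<delta> \<in> A" using that by (simp add: A_def)
      then obtain k where "\<delta> \<le> f k" using f(3) by blast
      then have "g \<delta> \<omega> \<le> g (f k) \<omega>" using that by (intro mono)
      also have "\<dots> \<le> ennreal c" using that by (auto simp: E_def not_less)
      finally show ?thesis .
    qed
    ultimately show ?thesis by (intro that[of "\<Union>k. E k"]) auto
  qed
qed

lemma with_high_prob_at_random_radius:
  fixes g :: "nat \<Rightarrow> real \<Rightarrow> 'w \<Rightarrow> ennreal" and d :: "nat \<Rightarrow> 'w \<Rightarrow> real"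
  assumes prob: "\<And>n. prob_space (P n)"
    and meas: "\<And>n \<delta>. 0 \<le> \<delta> \<Longrightarrow> g n \<delta> \<in> borel_measurable (P n)"
    and mono: "\<And>n \<delta> \<delta>' \<omega>. 0 \<le> \<delta> \<Longrightarrow> \<delta> \<le> \<delta>' \<Longrightarrow> g n \<delta> \<omega> \<le> g n \<delta>' \<omega>"
    and d: "\<And>n \<omega>. 0 \<le> d n \<omega>"
    and mean: "\<And>\<epsilon>. 0 < \<epsilon> \<Longrightarrow>
      with_high_prob P (\<lambda>n \<omega>. (\<integral>\<^sup>+\<omega>'. g n (d n \<omega>) \<omega>' \<partial>P n) \<le> ennreal \<epsilon>)"
    and "0 < c"
  shows "with_high_prob P (\<lambda>n \<omega>. g n (d n \<omega>) \<omega> \<le> ennreal c)"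
  unfolding with_high_prob_def
proof (intro allI impI)
  fix \<kappa> :: real assume \<kappa>: "0 < \<kappa>"
  define \<epsilon> where "\<epsilon> = c * \<kappa> / 2"
  have \<epsilon>: "0 < \<epsilon>" "\<epsilon> / c = \<kappa> / 2" using \<open>0 < c\<close> \<kappa> by (auto simp: \<epsilon>_def)
  have "0 < \<kappa> / 2" using \<kappa> by simp
  from with_high_probD[OF mean[OF \<epsilon>(1)] this]
  show "\<forall>\<^sub>F n in sequentially. \<exists>B\<in>sets (P n). measure (P n) B \<le> \<kappa> \<and>
      (\<forall>\<omega>\<in>space (P n) - B. g n (d n \<omega>) \<omega> \<le> ennreal c)"
  proof eventually_elim
    case (elim n)
    interpret prob_space "P n" by (rule prob)
    obtain B1 where B1: "B1 \<in> sets (P n)" "measure (P n) B1 \<le> \<kappa> / 2"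
      "\<forall>\<omega>\<in>space (P n) - B1. (\<integral>\<^sup>+\<omega>'. g n (d n \<omega>) \<omega>' \<partial>P n) \<le> ennreal \<epsilon>"
      using elim by blast
    obtain B2 where B2: "B2 \<in> sets (P n)" "measure (P n) B2 \<le> \<epsilon> / c"
      "\<And>\<delta> \<omega>. 0 \<le> \<delta> \<Longrightarrow> (\<integral>\<^sup>+\<omega>'. g n \<delta> \<omega>' \<partial>P n) \<le> ennreal \<epsilon> \<Longrightarrow> \<omega> \<in> space (P n) - B2 \<Longrightarrow> g n \<delta> \<omega> \<le> ennreal c"
      by (rule monotone_family_exceptional_set[of "g n" \<epsilon> c])
        (use meas mono \<epsilon> \<open>0 < c\<close> in auto)
    have "measure (P n) (B1 \<union> B2) \<le> measure (P n) B1 + measure (P n) B2"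
      using B1 B2 by (intro measure_Un_le)
    then show ?case
      using B1 B2 \<epsilon> d by (intro bexI[of _ "B1 \<union> B2"]) auto
  qed
qed

section \<open>Weak convergence and small perturbations\<close>

text \<open>Newton's step produces the normal sum with a minus sign; evenness of the characteristic
  function, that is, symmetry of \<open>\<mu>\<close>, absorbs it.\<close>

lemma weak_conv_m_uminus_symmetric:
  fixes S :: "nat \<Rightarrow> 'w \<Rightarrow> real"
  assumes prob: "\<And>n. prob_space (P n)"
    and S: "\<And>n. S n \<in> borel_measurable (P n)"
    and "real_distribution \<mu>" and sym: "\<And>t. char \<mu> (- t) = char \<mu> t"
    and conv: "weak_conv_m (\<lambda>n. distr (P n) borel (S n)) \<mu>"
  shows "weak_conv_m (\<lambda>n. distr (P n) borel (\<lambda>\<omega>. - S n \<omega>)) \<mu>"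
proof (rule levy_continuity)
  note [measurable] = S
  show "real_distribution (distr (P n) borel (\<lambda>\<omega>. - S n \<omega>))" for n
    by (rule prob_space.real_distribution_distr[OF prob]) measurable
  show "real_distribution \<mu>" by fact
  fix t
  have "char (distr (P n) borel (\<lambda>\<omega>. - S n \<omega>)) t = char (distr (P n) borel (S n)) (- t)" for n
    by (simp add: char_def integral_distr)
  moreover have "(\<lambda>n. char (distr (P n) borel (S n)) (- t)) \<longlonglongrightarrow> char \<mu> (- t)"
    by (rule levy_continuity1)
      (use assms in \<open>auto intro: prob_space.real_distribution_distr[OF prob]\<close>)
  ultimately show "(\<lambda>n. char (distr (P n) borel (\<lambda>\<omega>. - S n \<omega>)) t) \<longlonglongrightarrow> char \<mu> t"
    by (simp add: sym)
qed

lemma (in real_distribution) continuity_point_in_interval: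
  assumes "a < b"
  obtains y where "a < y" "y < b" "isCont (cdf M) y"
proof -
  have "\<not> {a<..<b} \<subseteq> {y. measure M {y} > 0}"
    using countable_atoms uncountable_open_interval[of a b] assms countable_subset by blast
  then obtain y where "y \<in> {a<..<b}" "\<not> measure M {y} > 0" by blast
  then have "isCont (cdf M) y" using measure_nonneg[of M "{y}"] by (simp add: isCont_cdf)
  with \<open>y \<in> {a<..<b}\<close> show ?thesis by (intro that) auto
qed

text \<open>Slutsky's lemma.  If \<open>\<bar>a\<bar>\<close> and \<open>\<bar>e\<bar>\<close> are at most \<open>\<eta> < 1\<close>, then \<open>Y \<le> x\<close> is equivalent to
  \<open>S \<le> x + a x - e\<close>, a threshold within \<open>\<eta> (\<bar>x\<bar> + 1)\<close> of \<open>x\<close>.  The distribution function of \<open>Y\<close> at \<open>x\<close> is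
  therefore squeezed between those of \<open>S\<close> at two continuity points of the limit on either side of \<open>x\<close>.\<close>

lemma weak_conv_m_asymptotically_equal:
  fixes S Y :: "nat \<Rightarrow> 'w \<Rightarrow> real"
  assumes prob: "\<And>n. prob_space (P n)"
    and S: "\<And>n. S n \<in> borel_measurable (P n)"
    and Y: "\<And>n. Y n \<in> borel_measurable (P n)"
    and \<mu>: "real_distribution \<mu>"
    and conv: "weak_conv_m (\<lambda>n. distr (P n) borel (S n)) \<mu>"
    and close: "\<And>\<eta>. 0 < \<eta> \<Longrightarrow> with_high_prob P
      (\<lambda>n \<omega>. \<exists>a e. \<bar>a\<bar> \<le> \<eta> \<and> \<bar>e\<bar> \<le> \<eta> \<and> (1 + a) * Y n \<omega> = S n \<omega> + e)"
  shows "weak_conv_m (\<lambda>n. distr (P n) borel (Y n)) \<mu>"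
  unfolding weak_conv_m_def weak_conv_def
proof (intro allI impI)
  interpret \<mu>: real_distribution \<mu> by fact
  note [measurable] = S Y
  have cdf: "cdf (distr (P n) borel Z) x = measure (P n) {\<omega>\<in>space (P n). Z \<omega> \<le> x}"
    if "Z \<in> borel_measurable (P n)" for n Z x
    using that by (simp add: cdf_def measure_distr vimage_def Int_def conj_commute)
  fix x assume x: "isCont (cdf \<mu>) x"
  have near: "\<exists>y1 y2. y1 < x \<and> x < y2 \<and> isCont (cdf \<mu>) y1 \<and> isCont (cdf \<mu>) y2 \<and>
      cdf \<mu> x - r < cdf \<mu> y1 \<and> cdf \<mu> y2 < cdf \<mu> x + r" if r: "0 < r" for r
  proof -
    obtain \<delta> where \<delta>: "0 < \<delta>" "\<And>y. \<bar>y - x\<bar> < \<delta> \<Longrightarrow> \<bar>cdf \<mu> y - cdf \<mu> x\<bar> < r"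
      using x r unfolding continuous_at_eps_delta by (auto simp: dist_real_def)
    obtain y1 where y1: "x - \<delta> < y1" "y1 < x" "isCont (cdf \<mu>) y1"
      by (rule \<mu>.continuity_point_in_interval[of "x - \<delta>" x]) (use \<delta> in auto)
    obtain y2 where y2: "x < y2" "y2 < x + \<delta>" "isCont (cdf \<mu>) y2"
      by (rule \<mu>.continuity_point_in_interval[of x "x + \<delta>"]) (use \<delta> in auto)
    show ?thesis
      using y1 y2 \<delta>(2)[of y1] \<delta>(2)[of y2] by (intro exI[of _ y1] exI[of _ y2]) auto
  qed
  show "(\<lambda>n. cdf (distr (P n) borel (Y n)) x) \<longlonglongrightarrow> cdf \<mu> x"
  proof (rule LIMSEQ_I)
    fix r0 :: real assume "0 < r0"
    define r where "r = r0 / 3"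
    have r: "0 < r" using \<open>0 < r0\<close> by (simp add: r_def)
    obtain y1 y2 where y: "y1 < x" "x < y2" "isCont (cdf \<mu>) y1" "isCont (cdf \<mu>) y2"
      "cdf \<mu> x - r < cdf \<mu> y1" "cdf \<mu> y2 < cdf \<mu> x + r"
      using near[OF r] by blast
    define \<eta> where "\<eta> = min (1/2) (min (x - y1) (y2 - x) / (\<bar>x\<bar> + 1))"
    have \<eta>: "0 < \<eta>" "\<eta> \<le> 1/2"
      using y unfolding \<eta>_def by (simp, intro min.cobounded1)
    have "\<eta> \<le> min (x - y1) (y2 - x) / (\<bar>x\<bar> + 1)" by (simp add: \<eta>_def)
    then have \<eta>x: "\<eta> * (\<bar>x\<bar> + 1) \<le> min (x - y1) (y2 - x)"
      by (simp add: pos_le_divide_eq)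
    have "(\<lambda>n. cdf (distr (P n) borel (S n)) y1) \<longlonglongrightarrow> cdf \<mu> y1"
      "(\<lambda>n. cdf (distr (P n) borel (S n)) y2) \<longlonglongrightarrow> cdf \<mu> y2"
      using conv y unfolding weak_conv_m_def weak_conv_def by auto
    then have "\<forall>\<^sub>F n in sequentially. cdf \<mu> y1 - r < cdf (distr (P n) borel (S n)) y1"
      "\<forall>\<^sub>F n in sequentially. cdf (distr (P n) borel (S n)) y2 < cdf \<mu> y2 + r"
      using r by (auto intro: order_tendstoD)
    with with_high_probD[OF close[OF \<eta>(1)] r]
    have "\<forall>\<^sub>F n in sequentially. norm (cdf (distr (P n) borel (Y n)) x - cdf \<mu> x) < r0"
    proof eventually_elim
      case (elim n)
      interpret prob_space "P n" by (rule prob)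
      obtain B where B[measurable]: "B \<in> sets (P n)" and "prob B \<le> r"
        and eq: "\<And>\<omega>. \<omega> \<in> space (P n) - B \<Longrightarrow>
          \<exists>a e. \<bar>a\<bar> \<le> \<eta> \<and> \<bar>e\<bar> \<le> \<eta> \<and> (1 + a) * Y n \<omega> = S n \<omega> + e"
        using elim(1) by blast
      have sandwich: "(S n \<omega> \<le> y1 \<longrightarrow> Y n \<omega> \<le> x) \<and> (Y n \<omega> \<le> x \<longrightarrow> S n \<omega> \<le> y2)"
        if \<omega>: "\<omega> \<in> space (P n) - B" for \<omega>
      proof -
        obtain a e where ae: "\<bar>a\<bar> \<le> \<eta>" "\<bar>e\<bar> \<le> \<eta>" "(1 + a) * Y n \<omega> = S n \<omega> + e"
          using eq[OF \<omega>] by blast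
        have pos: "0 < 1 + a" using ae \<eta> by linarith
        have "\<bar>a * x\<bar> \<le> \<eta> * \<bar>x\<bar>" using ae by (simp add: abs_mult mult_right_mono)
        then have "\<bar>a * x - e\<bar> \<le> \<eta> * (\<bar>x\<bar> + 1)"
          using ae(2) unfolding distrib_left by linarith
        then have ax: "\<bar>a * x - e\<bar> \<le> min (x - y1) (y2 - x)"
          using \<eta>x by (rule order_trans)
        have "Y n \<omega> \<le> x \<longleftrightarrow> (1 + a) * Y n \<omega> \<le> (1 + a) * x"
          using pos by simp
        also have "\<dots> \<longleftrightarrow> S n \<omega> \<le> x + (a * x - e)"
          unfolding ae(3) by (simp add: algebra_simps)
        finally show ?thesis using ax by auto
      qed
      have "prob {\<omega>\<in>space (P n). S n \<omega> \<le> y1} \<le> prob ({\<omega>\<in>space (P n). Y n \<omega> \<le> x} \<union> B)"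
        using sandwich by (intro finite_measure_mono) auto
      also have "\<dots> \<le> prob {\<omega>\<in>space (P n). Y n \<omega> \<le> x} + prob B"
        by (intro measure_Un_le) measurable
      finally have "prob {\<omega>\<in>space (P n). S n \<omega> \<le> y1} \<le> prob {\<omega>\<in>space (P n). Y n \<omega> \<le> x} + r"
        using \<open>prob B \<le> r\<close> by simp
      moreover
      have "prob {\<omega>\<in>space (P n). Y n \<omega> \<le> x} \<le> prob ({\<omega>\<in>space (P n). S n \<omega> \<le> y2} \<union> B)"
        using sandwich by (intro finite_measure_mono) auto
      then have "prob {\<omega>\<in>space (P n). Y n \<omega> \<le> x} \<le> prob {\<omega>\<in>space (P n). S n \<omega> \<le> y2} + prob B"
        using measure_Un_le[of "{\<omega>\<in>space (P n). S n \<omega> \<le> y2}" "P n" B] by simp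
      then have "prob {\<omega>\<in>space (P n). Y n \<omega> \<le> x} \<le> prob {\<omega>\<in>space (P n). S n \<omega> \<le> y2} + r"
        using \<open>prob B \<le> r\<close> by simp
      ultimately show ?case
        using elim y r unfolding cdf[OF S] cdf[OF Y] by (simp add: r_def abs_less_iff)
    qed
    then show "\<exists>no. \<forall>n\<ge>no. norm (cdf (distr (P n) borel (Y n)) x - cdf \<mu> x) < r0"
      by (simp add: eventually_sequentially)
  qed
qed

section \<open>Deterministic bounds\<close>

lemma tau_mono:
  assumes "\<delta> \<le> \<delta>'"
  shows "tau \<Theta> \<theta> m' \<delta> x \<le> tau \<Theta> \<theta> m' \<delta>' x"
proof (cases "{\<theta> - \<delta>'..\<theta> + \<delta>'} \<subseteq> \<Theta>")
  case True
  moreover from this assms have "{\<theta> - \<delta>..\<theta> + \<delta>} \<subseteq> \<Theta>" by auto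
  ultimately show ?thesis
    using assms by (auto simp: tau_def intro!: SUP_subset_mono)
qed (simp add: tau_def)

lemma tau_upper:
  assumes "\<bar>t - \<theta>\<bar> \<le> \<delta>"
  shows "ennreal \<bar>m' t x - m' \<theta> x\<bar> \<le> tau \<Theta> \<theta> m' \<delta> x"
  unfolding tau_def using assms by (auto intro!: SUP_upper)

text \<open>The remainder is the integral of \<open>m' s x - m' \<theta> x\<close> over \<open>s\<close> between \<open>\<theta>\<close> and \<open>t\<close>.  If the ball
  around \<open>\<theta>\<close> leaves \<open>\<Theta>\<close>, then \<open>tau\<close> is infinite and the bound is trivial, except for \<open>t = \<theta>\<close>,
  where both sides vanish.\<close>

lemma first_order_remainder_le_tau:
  fixes m m' :: "real \<Rightarrow> 'x \<Rightarrow> real"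
  assumes int: "\<And>t1 t2. t1 < t2 \<Longrightarrow> {t1..t2} \<subseteq> \<Theta> \<Longrightarrow>
      set_integrable lebesgue {t1..t2} (\<lambda>t. m' t x) \<and>
      m t2 x - m t1 x = (LINT t:{t1..t2}|lebesgue. m' t x)"
  shows "ennreal \<bar>m t x - m \<theta> x - (t - \<theta>) * m' \<theta> x\<bar>
           \<le> ennreal \<bar>t - \<theta>\<bar> * tau \<Theta> \<theta> m' \<bar>t - \<theta>\<bar> x"
proof (cases "t = \<theta> \<or> tau \<Theta> \<theta> m' \<bar>t - \<theta>\<bar> x = \<infinity>")
  case True
  then show ?thesis by (auto simp: ennreal_mult_top)
next
  case False
  then obtain T where T: "0 \<le> T" "tau \<Theta> \<theta> m' \<bar>t - \<theta>\<bar> x = ennreal T"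
    by (metis ennreal_cases infinity_ennreal_def)
  from False have ball: "{\<theta> - \<bar>t - \<theta>\<bar>..\<theta> + \<bar>t - \<theta>\<bar>} \<subseteq> \<Theta>"
    by (auto simp: tau_def split: if_splits)
  define a b where "a = min t \<theta>" and "b = max t \<theta>"
  have ab: "a < b" "{a..b} \<subseteq> \<Theta>" "b - a = \<bar>t - \<theta>\<bar>"
    using False ball by (auto simp: a_def b_def min_def max_def subset_eq split: if_splits)
  have dev: "\<bar>m' s x - m' \<theta> x\<bar> \<le> T" if "s \<in> {a..b}" for s
  proof -
    have "\<bar>s - \<theta>\<bar> \<le> \<bar>t - \<theta>\<bar>" using that by (auto simp: a_def b_def)
    from tau_upper[OF this, of m' x \<Theta>] show ?thesis using T by simp
  qed
  have mi: "set_integrable lebesgue {a..b} (\<lambda>s. m' s x)"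
    and mab: "m b x - m a x = (LINT s:{a..b}|lebesgue. m' s x)"
    using int[OF ab(1,2)] by auto
  have ci: "set_integrable lebesgue {a..b} (\<lambda>s. c)" for c :: real
    using continuous_imp_integrable[of a b "\<lambda>_. c"] by (simp add: continuous_on_const)
  have cv: "(LINT s:{a..b}|lebesgue. c) = (b - a) * c" for c :: real
    using ab by (simp add: set_lebesgue_integral_def)
  have "m b x - m a x - (b - a) * m' \<theta> x = (LINT s:{a..b}|lebesgue. m' s x - m' \<theta> x)"
    using set_integral_diff(2)[OF mi ci[of "m' \<theta> x"]] mab cv by simp
  also have "\<bar>\<dots>\<bar> \<le> (LINT s:{a..b}|lebesgue. \<bar>m' s x - m' \<theta> x\<bar>)"
    using set_integral_norm_bound[OF set_integral_diff(1)[OF mi ci[of "m' \<theta> x"]]] by simp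
  also have "\<dots> \<le> (LINT s:{a..b}|lebesgue. T)"
    using set_integral_diff(1)[OF mi ci[of "m' \<theta> x"]] dev
    by (intro set_integral_mono set_integrable_abs ci) auto
  also have "\<dots> = \<bar>t - \<theta>\<bar> * T" using cv ab by simp
  finally have "\<bar>m b x - m a x - (b - a) * m' \<theta> x\<bar> \<le> \<bar>t - \<theta>\<bar> * T" .
  moreover have "\<bar>m b x - m a x - (b - a) * m' \<theta> x\<bar> = \<bar>m t x - m \<theta> x - (t - \<theta>) * m' \<theta> x\<bar>"
    by (cases "t \<le> \<theta>") (auto simp: a_def b_def min_def max_def abs_real_def algebra_simps)
  ultimately show ?thesis
    using T by (simp add: ennreal_mult[symmetric] ennreal_leI)
qed

lemma nn_integral_weighted_tau:
  assumes "\<And>i. i \<in> I \<Longrightarrow> (\<lambda>\<omega>. tau \<Theta> \<theta> (m' i) \<delta> (Y i \<omega>)) \<in> borel_measurable Q"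
  shows "(\<integral>\<^sup>+\<omega>. K * (\<Sum>i\<in>I. w i * tau \<Theta> \<theta> (m' i) \<delta> (Y i \<omega>)) / C \<partial>Q)
           = K * (\<Sum>i\<in>I. w i * tau_bar Q (Y i) \<Theta> \<theta> (m' i) \<delta>) / C"
proof -
  note [measurable] = assms
  have "(\<integral>\<^sup>+\<omega>. K * (\<Sum>i\<in>I. w i * tau \<Theta> \<theta> (m' i) \<delta> (Y i \<omega>)) / C \<partial>Q)
      = K * (\<Sum>i\<in>I. \<integral>\<^sup>+\<omega>. w i * tau \<Theta> \<theta> (m' i) \<delta> (Y i \<omega>) \<partial>Q) / C"
    by (simp add: nn_integral_divide nn_integral_cmult nn_integral_sum)
  also have "(\<Sum>i\<in>I. \<integral>\<^sup>+\<omega>. w i * tau \<Theta> \<theta> (m' i) \<delta> (Y i \<omega>) \<partial>Q)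
      = (\<Sum>i\<in>I. w i * tau_bar Q (Y i) \<Theta> \<theta> (m' i) \<delta>)"
    by (intro sum.cong refl) (simp add: nn_integral_cmult tau_bar_def)
  finally show ?thesis .
qed

text \<open>The majorant is computed in \<open>ennreal\<close>, where a vanishing weight cancels an infinite \<open>T i\<close>; this
  is harmless, because then \<open>H i = 0\<close> as well.\<close>

lemma weighted_sum_le_majorant:
  fixes H W r :: "'i \<Rightarrow> real" and T :: "'i \<Rightarrow> ennreal"
  assumes "\<And>i. i \<in> I \<Longrightarrow> \<bar>H i\<bar> \<le> W i"
    and "\<And>i. i \<in> I \<Longrightarrow> ennreal \<bar>r i\<bar> \<le> K * T i"
    and "K * (\<Sum>i\<in>I. ennreal (W i) * T i) / ennreal s \<le> ennreal c"
    and "0 < s" "0 \<le> c"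
  shows "\<bar>\<Sum>i\<in>I. H i * r i\<bar> / s \<le> c"
proof -
  have "ennreal \<bar>\<Sum>i\<in>I. H i * r i\<bar> \<le> ennreal (\<Sum>i\<in>I. \<bar>H i\<bar> * \<bar>r i\<bar>)"
    using sum_abs[of "\<lambda>i. H i * r i" I] by (intro ennreal_leI) (simp add: abs_mult)
  also have "\<dots> = (\<Sum>i\<in>I. ennreal \<bar>H i\<bar> * ennreal \<bar>r i\<bar>)"
    by (simp add: sum_ennreal[symmetric] ennreal_mult)
  also have "\<dots> \<le> (\<Sum>i\<in>I. ennreal (W i) * (K * T i))"
    using assms by (intro sum_mono mult_mono ennreal_leI) auto
  also have "\<dots> = K * (\<Sum>i\<in>I. ennreal (W i) * T i)"
    by (simp add: sum_distrib_left mult_ac)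
  finally have "ennreal \<bar>\<Sum>i\<in>I. H i * r i\<bar> / ennreal s \<le> ennreal c"
    using divide_right_mono_ennreal assms(3) order_trans by blast
  then show ?thesis
    using assms(4,5) by (simp add: divide_ennreal)
qed

lemma weighted_sum_expansion:
  fixes F :: "nat \<Rightarrow> nat \<Rightarrow> real \<Rightarrow> 'x \<Rightarrow> real"
  shows "weighted_sum h F n t x =
    (\<Sum>i=1..n. h n i \<theta> * F n i \<theta> (x i)) + (\<Sum>i=1..n. (h n i t - h n i \<theta>) * F n i \<theta> (x i))
    + (\<Sum>i=1..n. h n i t * (F n i t (x i) - F n i \<theta> (x i)))"
  unfolding weighted_sum_def sum.distrib[symmetric] by (intro sum.cong refl) (simp add: algebra_simps)

text \<open>The left side is \<open>(t - \<theta>) D - N\<close>, with \<open>N\<close> the numerator of the one-step estimator; expanding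
  \<open>M n i t\<close> to first order at \<open>\<theta>\<close>, its linear term cancels against \<open>(t - \<theta>) D\<close> up to the variation of
  \<open>M'\<close>.\<close>

lemma one_step_error:
  assumes "weighted_sum h M' n t x \<noteq> 0"
  shows "weighted_sum h M' n t x * (one_step h M M' n t x - \<theta>) =
    - (\<Sum>i=1..n. h n i \<theta> * M n i \<theta> (x i)) - (\<Sum>i=1..n. (h n i t - h n i \<theta>) * M n i \<theta> (x i))
    + (\<Sum>i=1..n. h n i t * ((t - \<theta>) * (M' n i t (x i) - M' n i \<theta> (x i))))
    - (\<Sum>i=1..n. h n i t * (M n i t (x i) - M n i \<theta> (x i) - (t - \<theta>) * M' n i \<theta> (x i)))"
proof -
  have "weighted_sum h M' n t x * (one_step h M M' n t x - \<theta>)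
      = (t - \<theta>) * weighted_sum h M' n t x - weighted_sum h M n t x"
    using assms by (simp add: one_step_def field_simps)
  also have "\<dots> = - (\<Sum>i=1..n. h n i \<theta> * M n i \<theta> (x i))
      - (\<Sum>i=1..n. (h n i t - h n i \<theta>) * M n i \<theta> (x i))
      + (\<Sum>i=1..n. h n i t * ((t - \<theta>) * (M' n i t (x i) - M' n i \<theta> (x i))))
      - (\<Sum>i=1..n. h n i t * (M n i t (x i) - M n i \<theta> (x i) - (t - \<theta>) * M' n i \<theta> (x i)))"
    unfolding weighted_sum_def sum_distrib_left sum.distrib[symmetric] sum_subtractf[symmetric]
      sum_negf[symmetric]
    by (intro sum.cong refl) (simp add: algebra_simps)
  finally show ?thesis .
qed

lemma Hoelder_imp_continuous_on:
  fixes f :: "real \<Rightarrow> real"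
  assumes "0 < p"
    and "\<And>s t. s \<in> A \<Longrightarrow> t \<in> A \<Longrightarrow> \<bar>f s - f t\<bar> \<le> C * \<bar>s - t\<bar> powr p"
  shows "continuous_on A f"
  unfolding continuous_on_def
proof
  fix t assume "t \<in> A"
  have "((\<lambda>s. f s - f t) \<longlongrightarrow> 0) (at t within A)"
  proof (rule tendsto_rabs_zero_cancel, rule tendsto_sandwich[where f = "\<lambda>_. 0"])
    have "((\<lambda>s. s) \<longlongrightarrow> t) (at t within A)" by (rule tendsto_ident_at)
    then have "((\<lambda>s. \<bar>s - t\<bar>) \<longlongrightarrow> 0) (at t within A)"
      by (intro tendsto_rabs_zero LIM_zero)
    then have "((\<lambda>s. \<bar>s - t\<bar> powr p) \<longlongrightarrow> 0) (at t within A)"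
      using \<open>0 < p\<close> by (intro tendsto_zero_powrI) auto
    then show "((\<lambda>s. C * \<bar>s - t\<bar> powr p) \<longlongrightarrow> 0) (at t within A)"
      by (rule tendsto_mult_right_zero)
    show "\<forall>\<^sub>F s in at t within A. \<bar>f s - f t\<bar> \<le> C * \<bar>s - t\<bar> powr p"
      using assms(2) \<open>t \<in> A\<close> by (auto simp: eventually_at_filter)
  qed auto
  then show "(f \<longlongrightarrow> f t) (at t within A)" by (simp add: LIM_zero_iff)
qed

section \<open>Asymptotic normality of the one-step estimator\<close>

theorem mainTheorem1:
  fixes P :: "nat \<Rightarrow> 'w measure"
    and S :: "'x measure"
    and X :: "nat \<Rightarrow> nat \<Rightarrow> 'w \<Rightarrow> 'x"
    and \<Theta> :: "real set"
    and \<theta> p :: real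
    and h :: "nat \<Rightarrow> nat \<Rightarrow> real \<Rightarrow> real"
    and hbar :: "nat \<Rightarrow> nat \<Rightarrow> real"
    and M M' :: "nat \<Rightarrow> nat \<Rightarrow> real \<Rightarrow> 'x \<Rightarrow> real"
    and \<theta>s :: "nat \<Rightarrow> 'w \<Rightarrow> real"
  \<comment> \<open>the observations\<close>
  assumes prob: "\<And>n. prob_space (P n)"
    and indep: "\<And>n. prob_space.indep_vars (P n) (\<lambda>_. S) (X n) {1..n}"
    and param: "open \<Theta>" "\<theta> \<in> \<Theta>"
  \<comment> \<open>measurability of the given functions and of the random quantities built from them\<close>
    and M_meas: "\<And>n i t. i \<in> {1..n} \<Longrightarrow> t \<in> \<Theta> \<Longrightarrow> M n i t \<in> borel_measurable S"
    and M'_meas: "\<And>n i t. i \<in> {1..n} \<Longrightarrow> t \<in> \<Theta> \<Longrightarrow> M' n i t \<in> borel_measurable S"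
    and tau_meas: "\<And>n i \<delta>. i \<in> {1..n} \<Longrightarrow> 0 \<le> \<delta> \<Longrightarrow>
          (\<lambda>\<omega>. tau \<Theta> \<theta> (M' n i) \<delta> (X n i \<omega>)) \<in> borel_measurable (P n)"
    and M_est_meas: "\<And>n i. i \<in> {1..n} \<Longrightarrow>
          (\<lambda>\<omega>. M n i (\<theta>s n \<omega>) (X n i \<omega>))
            \<in> borel_measurable (restrict_space (P n) {\<omega> \<in> space (P n). \<theta>s n \<omega> \<in> \<Theta>})"
    and M'_est_meas: "\<And>n i. i \<in> {1..n} \<Longrightarrow>
          (\<lambda>\<omega>. M' n i (\<theta>s n \<omega>) (X n i \<omega>))
            \<in> borel_measurable (restrict_space (P n) {\<omega> \<in> space (P n). \<theta>s n \<omega> \<in> \<Theta>})"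
  \<comment> \<open>the preliminary estimator: a consistent statistic\<close>
    and statistic: "\<And>n. \<exists>T \<in> borel_measurable (PiM {1..n} (\<lambda>_. S)).
          \<forall>\<omega> \<in> space (P n). \<theta>s n \<omega> = T (\<lambda>i\<in>{1..n}. X n i \<omega>)"
    and consistent: "tendsto_in_prob P \<theta>s \<theta>"
  \<comment> \<open>(R2)\<close>
    and R2_integral: "\<And>n. AE \<omega> in P n. \<forall>i\<in>{1..n}. \<forall>t1 t2. t1 < t2 \<longrightarrow> {t1..t2} \<subseteq> \<Theta> \<longrightarrow>
          set_integrable lebesgue {t1..t2} (\<lambda>t. M' n i t (X n i \<omega>)) \<and>
          M n i t2 (X n i \<omega>) - M n i t1 (X n i \<omega>)
            = (LINT t:{t1..t2}|lebesgue. M' n i t (X n i \<omega>))"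
    and R2_square: "\<And>n i. i \<in> {1..n} \<Longrightarrow> integrable (P n) (\<lambda>\<omega>. (M n i \<theta> (X n i \<omega>))\<^sup>2)"
    and R2_mean: "\<And>n i. i \<in> {1..n} \<Longrightarrow> (\<integral>\<omega>. M n i \<theta> (X n i \<omega>) \<partial>P n) = 0"
    and R2_deriv: "\<And>n i. i \<in> {1..n} \<Longrightarrow> integrable (P n) (\<lambda>\<omega>. M' n i \<theta> (X n i \<omega>))"
    and R2_p: "0 < p" "p \<le> 1"
    and R2_hbar: "\<And>n i. i \<in> {1..n} \<Longrightarrow> 0 \<le> hbar n i"
    and R2_Hoelder: "\<And>n i t1 t2. i \<in> {1..n} \<Longrightarrow> t1 \<in> \<Theta> \<Longrightarrow> t2 \<in> \<Theta> \<Longrightarrow>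
          \<bar>h n i t1 - h n i t2\<bar> \<le> hbar n i * \<bar>t1 - t2\<bar> powr p"
  \<comment> \<open>(R3)\<close>
    and R3_I: "\<forall>\<^sub>F n in sequentially. 0 < I_nh P X \<theta> h M n"
    and R3_J: "\<forall>\<^sub>F n in sequentially. J_nh P X \<theta> h M' n \<noteq> 0"
    and R3_ratio: "filterlim (\<lambda>n. \<bar>J_nh P X \<theta> h M' n\<bar> / sqrt (I_nh P X \<theta> h M n)) at_top sequentially"
    and R3_lln: "tendsto_in_prob P
          (\<lambda>n \<omega>. (\<Sum>i=1..n. h n i \<theta> * M' n i \<theta> (X n i \<omega>)) / J_nh P X \<theta> h M' n) 1"
    and R3_clt: "weak_conv_m
          (\<lambda>n. distr (P n) borel
             (\<lambda>\<omega>. (\<Sum>i=1..n. h n i \<theta> * M n i \<theta> (X n i \<omega>)) / sqrt (I_nh P X \<theta> h M n)))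
          std_normal_distribution"
  \<comment> \<open>(R4)\<close>
    and R4: "((\<lambda>\<delta>. limsup (\<lambda>n.
          (\<Sum>i=1..n. ennreal (\<bar>h n i \<theta>\<bar> + \<delta> powr p * hbar n i)
                       * tau_bar (P n) (X n i) \<Theta> \<theta> (M' n i) \<delta>)
            / ennreal \<bar>J_nh P X \<theta> h M' n\<bar>)) \<longlongrightarrow> 0) (at_right 0)"
  \<comment> \<open>(R5)\<close>
    and R5_tau: "vanishes_in_prob P (\<lambda>n \<omega>.
          ennreal \<bar>\<theta>s n \<omega> - \<theta>\<bar>
            * (\<Sum>i=1..n. ennreal (hbar n i * \<bar>\<theta>s n \<omega> - \<theta>\<bar> powr p + \<bar>h n i \<theta>\<bar>)
                         * tau_bar (P n) (X n i) \<Theta> \<theta> (M' n i) \<bar>\<theta>s n \<omega> - \<theta>\<bar>)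
            / ennreal (sqrt (I_nh P X \<theta> h M n)))"
    and R5_deriv: "tendsto_in_prob P (\<lambda>n \<omega>.
          \<bar>\<theta>s n \<omega> - \<theta>\<bar> powr p * (\<Sum>i=1..n. hbar n i * (\<integral>\<omega>'. \<bar>M' n i \<theta> (X n i \<omega>')\<bar> \<partial>P n))
            / \<bar>J_nh P X \<theta> h M' n\<bar>) 0"
  \<comment> \<open>\<open>\<delta>\<^sub>n\<^sup>h \<rightarrow> 0\<close> in probability; it is only defined on the event \<open>\<theta>s n \<in> \<Theta>\<close>,
      whose probability tends to 1 by consistency\<close>
    and delta_h: "tendsto_in_prob P (\<lambda>n \<omega>.
          if \<theta>s n \<omega> \<in> \<Theta>
          then (\<Sum>i=1..n. (h n i (\<theta>s n \<omega>) - h n i \<theta>) * M n i \<theta> (X n i \<omega>)) / sqrt (I_nh P X \<theta> h M n)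
          else 0) 0"
  shows "(\<lambda>n. measure (P n) {\<omega> \<in> space (P n).
            one_step_well_defined \<Theta> h M' n (\<theta>s n \<omega>) (\<lambda>i. X n i \<omega>)}) \<longlonglongrightarrow> 1
         \<and>
         (\<forall>\<theta>ss :: nat \<Rightarrow> 'w \<Rightarrow> real.
           (\<forall>n. \<theta>ss n \<in> borel_measurable (P n)) \<longrightarrow>
           (\<forall>n. \<forall>\<omega> \<in> space (P n).
              one_step_well_defined \<Theta> h M' n (\<theta>s n \<omega>) (\<lambda>i. X n i \<omega>) \<longrightarrow>
              \<theta>ss n \<omega> = one_step h M M' n (\<theta>s n \<omega>) (\<lambda>i. X n i \<omega>)) \<longrightarrow>
           weak_conv_m
             (\<lambda>n. distr (P n) borel
                (\<lambda>\<omega>. J_nh P X \<theta> h M' n / sqrt (I_nh P X \<theta> h M n) * (\<theta>ss n \<omega> - \<theta>)))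
             std_normal_distribution)"
    \<comment> \<open>\<open>\<theta>ss\<close> is the one-step estimator, with arbitrary values where it is not well defined\<close>
proof (intro conjI allI impI)
  define s where "s n = sqrt (I_nh P X \<theta> h M n)" for n
  define J where "J n = J_nh P X \<theta> h M' n" for n
  define d where "d n \<omega> = \<bar>\<theta>s n \<omega> - \<theta>\<bar>" for n \<omega>
  define D where "D n \<omega> = weighted_sum h M' n (\<theta>s n \<omega>) (\<lambda>i. X n i \<omega>)" for n \<omega>
  define S0 where "S0 n \<omega> = (\<Sum>i=1..n. h n i \<theta> * M n i \<theta> (X n i \<omega>)) / s n" for n \<omega>
  have ev: "\<forall>\<^sub>F n in sequentially. 0 < s n \<and> J n \<noteq> 0"
    using R3_I R3_J by eventually_elim (simp add: s_def J_def)
  have d0: "0 \<le> d n \<omega>" for n \<omega> by (simp add: d_def)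

  have \<theta>s_meas[measurable]: "\<theta>s n \<in> borel_measurable (P n)" for n
    using consistent by (simp add: tendsto_in_prob_def)
  have X_meas: "X n i \<in> measurable (P n) S" if "i \<in> {1..n}" for n i
    using indep that by (auto simp: prob_space.indep_vars_def[OF prob])
  have M_comp[measurable]: "(\<lambda>\<omega>. M n i \<theta> (X n i \<omega>)) \<in> borel_measurable (P n)" if "i \<in> {1..n}" for n i
    using measurable_compose[OF X_meas[OF that] M_meas[OF that param(2)]] .

  have near: "with_high_prob P (\<lambda>n \<omega>. d n \<omega> \<le> r)" if "0 < r" for r
    using tendsto_in_prob_with_high_prob[OF consistent that] by (simp add: d_def)

  have in_\<Theta>: "with_high_prob P (\<lambda>n \<omega>. \<theta>s n \<omega> \<in> \<Theta>)"
  proof -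
    obtain r where r: "0 < r" "cball \<theta> r \<subseteq> \<Theta>" using param by (meson open_contains_cball)
    show ?thesis
      by (rule with_high_prob_mono[OF near[OF r(1)]])
        (use r in \<open>auto simp: d_def dist_real_def subset_eq abs_minus_commute\<close>)
  qed

  \<comment> \<open>One majorant for both uses: with \<open>K \<delta> = \<delta>\<close> and \<open>C = s\<close> its mean is the quantity in
      \<open>R5_tau\<close>, with \<open>K \<delta> = 1\<close> and \<open>C = \<bar>J\<bar>\<close> the one in \<open>R4\<close>.\<close>
  define G where "G K C n \<delta> \<omega> =
      K \<delta> * (\<Sum>i=1..n. ennreal (\<bar>h n i \<theta>\<bar> + \<delta> powr p * hbar n i)
                       * tau \<Theta> \<theta> (M' n i) \<delta> (X n i \<omega>)) / ennreal (C n)"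
    for K :: "real \<Rightarrow> ennreal" and C :: "nat \<Rightarrow> real" and n \<delta> \<omega>
  have G_mono: "G K C n \<delta> \<omega> \<le> G K C n \<delta>' \<omega>"
    if "mono K" "0 \<le> \<delta>" "\<delta> \<le> \<delta>'" for K C n \<delta> \<delta>' \<omega>
    unfolding G_def using that R2_hbar R2_p
    by (intro divide_right_mono_ennreal mult_mono sum_mono tau_mono ennreal_leI add_left_mono
        mult_right_mono powr_mono2) (auto simp: mono_def)
  have G_meas: "G K C n \<delta> \<in> borel_measurable (P n)" if "0 \<le> \<delta>" for K C n \<delta>
  proof -
    note [measurable] = tau_meas[OF _ that]
    show ?thesis unfolding G_def by measurable
  qed
  have G_int: "(\<integral>\<^sup>+\<omega>. G K C n \<delta> \<omega> \<partial>P n) =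
      K \<delta> * (\<Sum>i=1..n. ennreal (\<bar>h n i \<theta>\<bar> + \<delta> powr p * hbar n i)
                       * tau_bar (P n) (X n i) \<Theta> \<theta> (M' n i) \<delta>) / ennreal (C n)"
    if "0 \<le> \<delta>" for K C n \<delta>
    unfolding G_def by (rule nn_integral_weighted_tau) (rule tau_meas[OF _ that])

  have score: "with_high_prob P (\<lambda>n \<omega>. G ennreal s n (d n \<omega>) \<omega> \<le> ennreal c)" if "0 < c" for c
  proof (rule with_high_prob_at_random_radius[OF prob])
    fix \<epsilon> :: real assume "0 < \<epsilon>"
    from vanishes_in_prob_with_high_prob[OF R5_tau this]
    show "with_high_prob P (\<lambda>n \<omega>. (\<integral>\<^sup>+\<omega>'. G ennreal s n (d n \<omega>) \<omega>' \<partial>P n) \<le> ennreal \<epsilon>)"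
      unfolding G_int[OF d0] by (simp add: d_def s_def add.commute mult.commute[of "_ powr p"])
  next
    show "G ennreal s n \<delta> \<omega> \<le> G ennreal s n \<delta>' \<omega>" if "0 \<le> \<delta>" "\<delta> \<le> \<delta>'" for n \<delta> \<delta>' \<omega>
      using that by (intro G_mono monoI ennreal_leI)
  qed (use G_meas d0 that in auto)

  \<comment> \<open>\<open>R4\<close> speaks about fixed small radii; monotonicity transfers it to \<open>d n \<omega>\<close>, which by consistency
      is below such a radius with high probability.\<close>
  have denom: "with_high_prob P (\<lambda>n \<omega>. G (\<lambda>_. 1) (\<lambda>n. \<bar>J n\<bar>) n (d n \<omega>) \<omega> \<le> ennreal c)"
    if "0 < c" for c
  proof (rule with_high_prob_at_random_radius[OF prob])
    fix \<epsilon> :: real assume \<epsilon>: "0 < \<epsilon>"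
    let ?E = "\<lambda>n \<delta>. \<integral>\<^sup>+\<omega>. G (\<lambda>_. 1) (\<lambda>n. \<bar>J n\<bar>) n \<delta> \<omega> \<partial>P n"
    have lim: "((\<lambda>\<delta>. limsup (\<lambda>n. ?E n \<delta>)) \<longlongrightarrow> 0) (at_right 0)"
      by (rule Lim_transform_eventually[OF R4])
        (auto simp: eventually_at_filter G_int J_def)
    have "\<forall>\<^sub>F \<delta> in at_right 0. limsup (\<lambda>n. ?E n \<delta>) < ennreal \<epsilon>"
      by (rule order_tendstoD(2)[OF lim]) (use \<epsilon> in simp)
    moreover have "\<forall>\<^sub>F \<delta> in at_right (0::real). 0 < \<delta>" by (simp add: eventually_at_filter)
    ultimately have "\<exists>\<delta>>0. limsup (\<lambda>n. ?E n \<delta>) < ennreal \<epsilon>"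
      using eventually_happens'[OF _ eventually_conj] by (metis (mono_tags, lifting) trivial_limit_at_right_real)
    then obtain \<delta> where \<delta>: "0 < \<delta>" "limsup (\<lambda>n. ?E n \<delta>) < ennreal \<epsilon>" by blast
    have "\<forall>\<^sub>F n in sequentially. ?E n \<delta> < ennreal \<epsilon>"
      using Limsup_lessD[OF \<delta>(2)] .
    then show "with_high_prob P (\<lambda>n \<omega>. ?E n (d n \<omega>) \<le> ennreal \<epsilon>)"
    proof (intro with_high_prob_mono[OF near[OF \<delta>(1)]], eventually_elim)
      case (elim n)
      show ?case
      proof (intro ballI impI)
        fix \<omega> assume "d n \<omega> \<le> \<delta>"
        then have "?E n (d n \<omega>) \<le> ?E n \<delta>"
          using d0 by (intro nn_integral_mono G_mono) (auto intro: monoI)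
        then show "?E n (d n \<omega>) \<le> ennreal \<epsilon>" using elim by simp
      qed
    qed
  qed (use G_meas G_mono d0 that in \<open>auto intro: monoI\<close>)

  \<comment> \<open>The majorant for the effect of replacing \<open>h\<^sub>i(t)\<close> by \<open>h\<^sub>i(\<theta>)\<close> in the denominator; its mean is the
      quantity in \<open>R5_deriv\<close>.\<close>
  define H where "H n \<delta> \<omega> =
      ennreal (\<delta> powr p) * (\<Sum>i=1..n. ennreal (hbar n i) * ennreal \<bar>M' n i \<theta> (X n i \<omega>)\<bar>) / ennreal \<bar>J n\<bar>"
    for n \<delta> \<omega>
  have H_int: "(\<integral>\<^sup>+\<omega>. H n \<delta> \<omega> \<partial>P n) =
      ennreal (\<delta> powr p * (\<Sum>i=1..n. hbar n i * (\<integral>\<omega>'. \<bar>M' n i \<theta> (X n i \<omega>')\<bar> \<partial>P n)) / \<bar>J n\<bar>)"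
    if "J n \<noteq> 0" for n \<delta>
  proof -
    note [measurable] = borel_measurable_integrable[OF R2_deriv]
    have "(\<integral>\<^sup>+\<omega>. H n \<delta> \<omega> \<partial>P n) = ennreal (\<delta> powr p) *
        (\<Sum>i=1..n. ennreal (hbar n i) * (\<integral>\<^sup>+\<omega>. ennreal \<bar>M' n i \<theta> (X n i \<omega>)\<bar> \<partial>P n)) / ennreal \<bar>J n\<bar>"
      unfolding H_def
      by (simp add: nn_integral_divide nn_integral_cmult nn_integral_sum del: One_nat_def)
    also have "(\<Sum>i=1..n. ennreal (hbar n i) * (\<integral>\<^sup>+\<omega>. ennreal \<bar>M' n i \<theta> (X n i \<omega>)\<bar> \<partial>P n))
        = (\<Sum>i=1..n. ennreal (hbar n i * (\<integral>\<omega>. \<bar>M' n i \<theta> (X n i \<omega>)\<bar> \<partial>P n)))"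
      using R2_hbar R2_deriv
      by (intro sum.cong refl) (simp add: nn_integral_eq_integral ennreal_mult)
    also have "\<dots> = ennreal (\<Sum>i=1..n. hbar n i * (\<integral>\<omega>. \<bar>M' n i \<theta> (X n i \<omega>)\<bar> \<partial>P n))"
      using R2_hbar by (intro sum_ennreal) simp
    finally have "(\<integral>\<^sup>+\<omega>. H n \<delta> \<omega> \<partial>P n) = ennreal (\<delta> powr p) *
        ennreal (\<Sum>i=1..n. hbar n i * (\<integral>\<omega>. \<bar>M' n i \<theta> (X n i \<omega>)\<bar> \<partial>P n)) / ennreal \<bar>J n\<bar>" .
    moreover have "0 \<le> (\<Sum>i=1..n. hbar n i * (\<integral>\<omega>. \<bar>M' n i \<theta> (X n i \<omega>)\<bar> \<partial>P n))"
      using R2_hbar by (intro sum_nonneg mult_nonneg_nonneg) auto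
    ultimately show ?thesis
      using that by (simp add: ennreal_mult[symmetric] divide_ennreal)
  qed
  have weights: "with_high_prob P (\<lambda>n \<omega>. H n (d n \<omega>) \<omega> \<le> ennreal c)" if "0 < c" for c
  proof (rule with_high_prob_at_random_radius[OF prob])
    fix \<epsilon> :: real assume "0 < \<epsilon>"
    from tendsto_in_prob_with_high_prob[OF R5_deriv this]
    show "with_high_prob P (\<lambda>n \<omega>. (\<integral>\<^sup>+\<omega>'. H n (d n \<omega>) \<omega>' \<partial>P n) \<le> ennreal \<epsilon>)"
    proof (rule with_high_prob_mono)
      from ev show "\<forall>\<^sub>F n in sequentially. \<forall>\<omega>\<in>space (P n).
          \<bar>\<bar>\<theta>s n \<omega> - \<theta>\<bar> powr p * (\<Sum>i=1..n. hbar n i * (\<integral>\<omega>'. \<bar>M' n i \<theta> (X n i \<omega>')\<bar> \<partial>P n))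
            / \<bar>J_nh P X \<theta> h M' n\<bar> - 0\<bar> \<le> \<epsilon> \<longrightarrow> (\<integral>\<^sup>+\<omega>'. H n (d n \<omega>) \<omega>' \<partial>P n) \<le> ennreal \<epsilon>"
      proof (eventually_elim, intro ballI impI)
        fix n \<omega> assume sJ: "0 < s n \<and> J n \<noteq> 0"
          and "\<bar>\<bar>\<theta>s n \<omega> - \<theta>\<bar> powr p * (\<Sum>i=1..n. hbar n i * (\<integral>\<omega>'. \<bar>M' n i \<theta> (X n i \<omega>')\<bar> \<partial>P n))
            / \<bar>J_nh P X \<theta> h M' n\<bar> - 0\<bar> \<le> \<epsilon>"
        then have "\<bar>\<theta>s n \<omega> - \<theta>\<bar> powr p * (\<Sum>i=1..n. hbar n i * (\<integral>\<omega>'. \<bar>M' n i \<theta> (X n i \<omega>')\<bar> \<partial>P n))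
            / \<bar>J_nh P X \<theta> h M' n\<bar> \<le> \<epsilon>"
          by linarith
        with sJ show "(\<integral>\<^sup>+\<omega>'. H n (d n \<omega>) \<omega>' \<partial>P n) \<le> ennreal \<epsilon>"
          unfolding d_def by (simp add: H_int J_def ennreal_leI del: One_nat_def)
      qed
    qed
  next
    show "H n \<delta> \<in> borel_measurable (P n)" for n \<delta>
    proof -
      note [measurable] = borel_measurable_integrable[OF R2_deriv]
      show ?thesis unfolding H_def by measurable
    qed
    show "H n \<delta> \<omega> \<le> H n \<delta>' \<omega>" if "0 \<le> \<delta>" "\<delta> \<le> \<delta>'" for n \<delta> \<delta>' \<omega>
      unfolding H_def using that R2_p
      by (intro divide_right_mono_ennreal mult_mono ennreal_leI powr_mono2) auto
  qed (use d0 that in auto)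

  \<comment> \<open>The factor 3 counts terms: three deviations make up \<open>a\<close>, and \<open>e\<close> consists of the \<open>\<delta>\<^sub>n\<^sup>h\<close> term and
      two remainders.\<close>
  have key: "with_high_prob P (\<lambda>n \<omega>. \<theta>s n \<omega> \<in> \<Theta> \<and> (\<exists>a e. \<bar>a\<bar> \<le> 3 * c \<and> \<bar>e\<bar> \<le> 3 * c \<and>
      D n \<omega> / J n = 1 + a \<and>
      (D n \<omega> \<noteq> 0 \<longrightarrow>
        (1 + a) * (J n / s n * (one_step h M M' n (\<theta>s n \<omega>) (\<lambda>i. X n i \<omega>) - \<theta>)) = - S0 n \<omega> + e)))"
    if c: "0 < c" for c
  proof (rule with_high_prob_mono)
    show "with_high_prob P (\<lambda>n \<omega>. (\<theta>s n \<omega> \<in> \<Theta> \<and>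
        G ennreal s n (d n \<omega>) \<omega> \<le> ennreal c \<and>
        G (\<lambda>_. 1) (\<lambda>n. \<bar>J n\<bar>) n (d n \<omega>) \<omega> \<le> ennreal c \<and>
        H n (d n \<omega>) \<omega> \<le> ennreal c) \<and>
        \<bar>(\<Sum>i=1..n. h n i \<theta> * M' n i \<theta> (X n i \<omega>)) / J_nh P X \<theta> h M' n - 1\<bar> \<le> c \<and>
        \<bar>(if \<theta>s n \<omega> \<in> \<Theta>
          then (\<Sum>i=1..n. (h n i (\<theta>s n \<omega>) - h n i \<theta>) * M n i \<theta> (X n i \<omega>)) / sqrt (I_nh P X \<theta> h M n)
          else 0) - 0\<bar> \<le> c \<and>
        (\<forall>i\<in>{1..n}. \<forall>t1 t2. t1 < t2 \<longrightarrow> {t1..t2} \<subseteq> \<Theta> \<longrightarrow>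
          set_integrable lebesgue {t1..t2} (\<lambda>t. M' n i t (X n i \<omega>)) \<and>
          M n i t2 (X n i \<omega>) - M n i t1 (X n i \<omega>)
            = (LINT t:{t1..t2}|lebesgue. M' n i t (X n i \<omega>))))"
      (is "with_high_prob P ?Good")
      by (intro with_high_prob_conj in_\<Theta> score denom weights c
          tendsto_in_prob_with_high_prob[OF R3_lln] tendsto_in_prob_with_high_prob[OF delta_h]
          with_high_prob_AE[OF R2_integral])
    show "\<forall>\<^sub>F n in sequentially. \<forall>\<omega>\<in>space (P n). ?Good n \<omega> \<longrightarrow>
      \<theta>s n \<omega> \<in> \<Theta> \<and> (\<exists>a e. \<bar>a\<bar> \<le> 3 * c \<and> \<bar>e\<bar> \<le> 3 * c \<and> D n \<omega> / J n = 1 + a \<and>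
      (D n \<omega> \<noteq> 0 \<longrightarrow>
        (1 + a) * (J n / s n * (one_step h M M' n (\<theta>s n \<omega>) (\<lambda>i. X n i \<omega>) - \<theta>)) = - S0 n \<omega> + e))"
      using ev
    proof (eventually_elim, intro ballI impI)
      fix n \<omega> assume sJ: "0 < s n \<and> J n \<noteq> 0" and good: "?Good n \<omega>"
      define t where "t = \<theta>s n \<omega>"
      have t: "t \<in> \<Theta>" using good by (simp add: t_def)
      have dt: "d n \<omega> = \<bar>t - \<theta>\<bar>" by (simp add: d_def t_def)
      define x where "x i = X n i \<omega>" for i
      have Hd: "\<bar>h n i t - h n i \<theta>\<bar> \<le> hbar n i * \<bar>t - \<theta>\<bar> powr p" if "i \<in> {1..n}" for i
        using R2_Hoelder[OF that t param(2)] .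
      have Hw: "\<bar>h n i t\<bar> \<le> \<bar>h n i \<theta>\<bar> + d n \<omega> powr p * hbar n i" if "i \<in> {1..n}" for i
        using Hd[OF that] by (simp add: dt mult.commute)
      have tau_M': "ennreal \<bar>M' n i t (x i) - M' n i \<theta> (x i)\<bar> \<le> tau \<Theta> \<theta> (M' n i) (d n \<omega>) (x i)" for i
        by (rule tau_upper) (simp add: dt)
      define A1 where "A1 = (\<Sum>i=1..n. (h n i t - h n i \<theta>) * M' n i \<theta> (x i)) / J n"
      define A2 where "A2 = (\<Sum>i=1..n. h n i t * (M' n i t (x i) - M' n i \<theta> (x i))) / J n"
      define R0 where "R0 = (\<Sum>i=1..n. (h n i t - h n i \<theta>) * M n i \<theta> (x i)) / s n"
      define R1 where "R1 = (\<Sum>i=1..n. h n i t * ((t - \<theta>) * (M' n i t (x i) - M' n i \<theta> (x i)))) / s n"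
      define R2 where "R2 =
        (\<Sum>i=1..n. h n i t * (M n i t (x i) - M n i \<theta> (x i) - (t - \<theta>) * M' n i \<theta> (x i))) / s n"
      have A1: "\<bar>A1\<bar> \<le> c"
        unfolding A1_def abs_divide
      proof (rule weighted_sum_le_majorant)
        show "\<bar>h n i t - h n i \<theta>\<bar> \<le> \<bar>t - \<theta>\<bar> powr p * hbar n i" if "i \<in> {1..n}" for i
          using Hd[OF that] by (simp add: mult.commute)
        have "(\<Sum>i=1..n. ennreal (\<bar>t - \<theta>\<bar> powr p * hbar n i) * ennreal \<bar>M' n i \<theta> (x i)\<bar>)
            = ennreal (\<bar>t - \<theta>\<bar> powr p) * (\<Sum>i=1..n. ennreal (hbar n i) * ennreal \<bar>M' n i \<theta> (x i)\<bar>)"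
          using R2_hbar by (simp add: sum_distrib_left ennreal_mult mult.assoc)
        then show "1 * (\<Sum>i=1..n. ennreal (\<bar>t - \<theta>\<bar> powr p * hbar n i) * ennreal \<bar>M' n i \<theta> (x i)\<bar>)
            / ennreal \<bar>J n\<bar> \<le> ennreal c"
          using good by (simp add: H_def dt x_def)
      qed (use sJ c in auto)
      have A2: "\<bar>A2\<bar> \<le> c"
        unfolding A2_def abs_divide
        by (rule weighted_sum_le_majorant[where K = 1
            and T = "\<lambda>i. tau \<Theta> \<theta> (M' n i) (d n \<omega>) (x i)", OF Hw])
          (use tau_M' good sJ c in \<open>auto simp: G_def x_def\<close>)
      have R1: "\<bar>R1\<bar> \<le> c"
      proof -
        have "\<bar>\<Sum>i=1..n. h n i t * ((t - \<theta>) * (M' n i t (x i) - M' n i \<theta> (x i)))\<bar> / s n \<le> c"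
        proof (rule weighted_sum_le_majorant[OF Hw])
          show "ennreal \<bar>(t - \<theta>) * (M' n i t (x i) - M' n i \<theta> (x i))\<bar>
              \<le> ennreal (d n \<omega>) * tau \<Theta> \<theta> (M' n i) (d n \<omega>) (x i)" for i
            unfolding abs_mult using tau_M'[of i] by (simp add: dt ennreal_mult mult_left_mono)
        qed (use good sJ c in \<open>auto simp: G_def x_def\<close>)
        then show ?thesis using sJ by (simp add: R1_def)
      qed
      have R2: "\<bar>R2\<bar> \<le> c"
      proof -
        have "\<bar>\<Sum>i=1..n. h n i t * (M n i t (x i) - M n i \<theta> (x i) - (t - \<theta>) * M' n i \<theta> (x i))\<bar> / s n \<le> c"
        proof (rule weighted_sum_le_majorant[OF Hw])
          show "ennreal \<bar>M n i t (x i) - M n i \<theta> (x i) - (t - \<theta>) * M' n i \<theta> (x i)\<bar>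
              \<le> ennreal (d n \<omega>) * tau \<Theta> \<theta> (M' n i) (d n \<omega>) (x i)" if "i \<in> {1..n}" for i
            unfolding dt by (rule first_order_remainder_le_tau) (use good that in \<open>auto simp: x_def\<close>)
        qed (use good sJ c in \<open>auto simp: G_def x_def\<close>)
        then show ?thesis using sJ by (simp add: R2_def)
      qed
      have R0: "\<bar>R0\<bar> \<le> c" using good by (auto simp: R0_def x_def t_def s_def)
      define a where "a = D n \<omega> / J n - 1"
      have "D n \<omega> / J n = (\<Sum>i=1..n. h n i \<theta> * M' n i \<theta> (x i)) / J n + A1 + A2"
        unfolding D_def A1_def A2_def weighted_sum_expansion[where \<theta> = \<theta>]
        by (simp add: add_divide_distrib t_def x_def)
      moreover have "\<bar>(\<Sum>i=1..n. h n i \<theta> * M' n i \<theta> (x i)) / J n - 1\<bar> \<le> c"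
        using good unfolding J_def x_def by blast
      ultimately have a: "\<bar>a\<bar> \<le> 3 * c" using A1 A2 unfolding a_def by linarith
      have "(1 + a) * (J n / s n * (one_step h M M' n t x - \<theta>)) = - S0 n \<omega> + (- R0 + R1 - R2)"
        if "D n \<omega> \<noteq> 0"
      proof -
        have "weighted_sum h M' n t x \<noteq> 0"
          using that by (simp add: D_def t_def x_def[abs_def])
        note err = one_step_error[OF this, of M \<theta>]
        have "(1 + a) * (J n / s n * (one_step h M M' n t x - \<theta>))
            = weighted_sum h M' n t x * (one_step h M M' n t x - \<theta>) / s n"
          using sJ by (simp add: a_def D_def t_def x_def[abs_def])
        also have "\<dots> = - S0 n \<omega> + (- R0 + R1 - R2)"
          unfolding err by (simp add: S0_def R0_def R1_def R2_def x_def add_divide_distrib diff_divide_distrib)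
        finally show ?thesis .
      qed
      moreover have "\<bar>- R0 + R1 - R2\<bar> \<le> 3 * c" using R0 R1 R2 by linarith
      ultimately show "\<theta>s n \<omega> \<in> \<Theta> \<and> (\<exists>a e. \<bar>a\<bar> \<le> 3 * c \<and> \<bar>e\<bar> \<le> 3 * c \<and> D n \<omega> / J n = 1 + a \<and>
          (D n \<omega> \<noteq> 0 \<longrightarrow>
            (1 + a) * (J n / s n * (one_step h M M' n (\<theta>s n \<omega>) (\<lambda>i. X n i \<omega>) - \<theta>)) = - S0 n \<omega> + e))"
        using t a by (intro conjI exI[of _ a] exI[of _ "- R0 + R1 - R2"])
          (auto simp: t_def x_def[abs_def] a_def)
    qed
  qed

  \<comment> \<open>Any \<open>c < 1/3\<close> would do: \<open>\<bar>D / J - 1\<bar> < 1\<close> forces \<open>D\<close> to be nonzero.\<close>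
  have well: "with_high_prob P (\<lambda>n \<omega>. one_step_well_defined \<Theta> h M' n (\<theta>s n \<omega>) (\<lambda>i. X n i \<omega>))"
    by (rule with_high_prob_mono[OF key[of "1/6"]])
      (auto simp: one_step_well_defined_def D_def intro!: always_eventually)

  show "(\<lambda>n. measure (P n) {\<omega> \<in> space (P n).
      one_step_well_defined \<Theta> h M' n (\<theta>s n \<omega>) (\<lambda>i. X n i \<omega>)}) \<longlonglongrightarrow> 1"
  proof (rule with_high_prob_measure_tendsto_1[OF prob _ well])
    fix n
    define E where "E = {\<omega> \<in> space (P n). \<theta>s n \<omega> \<in> \<Theta>}"
    have [measurable]: "\<Theta> \<in> sets borel" using param(1) by simp
    have E: "E \<in> sets (P n)" unfolding E_def by measurable
    have h_est: "(\<lambda>\<omega>. h n i (\<theta>s n \<omega>)) \<in> borel_measurable (restrict_space (P n) E)"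
      if "i \<in> {1..n}" for i
    proof (rule measurable_compose[where f = "\<theta>s n" and g = "h n i"])
      show "\<theta>s n \<in> measurable (restrict_space (P n) E) (restrict_space borel \<Theta>)"
        by (rule measurable_restrict_space3) (auto simp: E_def)
      show "h n i \<in> borel_measurable (restrict_space borel \<Theta>)"
        using R2_Hoelder[OF that] R2_p(1)
        by (intro borel_measurable_continuous_on_restrict Hoelder_imp_continuous_on) auto
    qed
    have "D n \<in> borel_measurable (restrict_space (P n) E)"
      unfolding D_def weighted_sum_def
      using h_est M'_est_meas by (intro borel_measurable_sum borel_measurable_times) (auto simp: E_def)
    then have "{\<omega> \<in> space (restrict_space (P n) E). D n \<omega> \<noteq> 0} \<in> sets (restrict_space (P n) E)"
      by measurable
    moreover have "{\<omega> \<in> space (restrict_space (P n) E). D n \<omega> \<noteq> 0} =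
        {\<omega> \<in> space (P n). one_step_well_defined \<Theta> h M' n (\<theta>s n \<omega>) (\<lambda>i. X n i \<omega>)}"
      by (auto simp: space_restrict_space E_def one_step_well_defined_def D_def)
    ultimately show "{\<omega> \<in> space (P n).
        one_step_well_defined \<Theta> h M' n (\<theta>s n \<omega>) (\<lambda>i. X n i \<omega>)} \<in> sets (P n)"
      using E by (simp add: sets_restrict_space_iff)
  qed

  fix \<theta>ss :: "nat \<Rightarrow> 'w \<Rightarrow> real"
  assume \<theta>ss_meas: "\<forall>n. \<theta>ss n \<in> borel_measurable (P n)"
    and \<theta>ss: "\<forall>n. \<forall>\<omega>\<in>space (P n). one_step_well_defined \<Theta> h M' n (\<theta>s n \<omega>) (\<lambda>i. X n i \<omega>) \<longrightarrow>
      \<theta>ss n \<omega> = one_step h M M' n (\<theta>s n \<omega>) (\<lambda>i. X n i \<omega>)"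
  have S0_meas: "S0 n \<in> borel_measurable (P n)" for n
    unfolding S0_def by measurable
  show "weak_conv_m (\<lambda>n. distr (P n) borel
      (\<lambda>\<omega>. J_nh P X \<theta> h M' n / sqrt (I_nh P X \<theta> h M n) * (\<theta>ss n \<omega> - \<theta>))) std_normal_distribution"
    unfolding J_def[symmetric] s_def[symmetric]
  proof (rule weak_conv_m_asymptotically_equal[OF prob _ _ real_dist_normal_dist])
    show "(\<lambda>\<omega>. - S0 n \<omega>) \<in> borel_measurable (P n)" for n
      using S0_meas by measurable
    show "(\<lambda>\<omega>. J n / s n * (\<theta>ss n \<omega> - \<theta>)) \<in> borel_measurable (P n)" for n
      using \<theta>ss_meas by (intro borel_measurable_times borel_measurable_diff borel_measurable_const) auto
    show "weak_conv_m (\<lambda>n. distr (P n) borel (\<lambda>\<omega>. - S0 n \<omega>)) std_normal_distribution"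
      by (rule weak_conv_m_uminus_symmetric[OF prob S0_meas real_dist_normal_dist])
        (use R3_clt in \<open>simp_all add: S0_def[abs_def] s_def char_std_normal_distribution\<close>)
    fix \<eta> :: real assume "0 < \<eta>"
    then have "0 < \<eta> / 3" by simp
    show "with_high_prob P (\<lambda>n \<omega>. \<exists>a e. \<bar>a\<bar> \<le> \<eta> \<and> \<bar>e\<bar> \<le> \<eta> \<and>
        (1 + a) * (J n / s n * (\<theta>ss n \<omega> - \<theta>)) = - S0 n \<omega> + e)"
      by (rule with_high_prob_mono[OF with_high_prob_conj[OF key[OF \<open>0 < \<eta> / 3\<close>] well]])
        (use \<theta>ss in \<open>auto simp: one_step_well_defined_def D_def intro!: always_eventually\<close>)
  qed
qed

end
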